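(* Let $M_n$ be a connected metrizable $n$-dimensional manifold, let $\mu$ be a measure on $M_n$ such that every nonempty open subset of $M_n$ has positive $\mu$-measure, and let $T$ be a symmetric operator acting on a subspace of $L_2(M_n,\mu)$. Then there is at most one eigenspace of $T$ that contains a real valued continuous function $\psi$ whose nodal set $N_\psi=\{x\in M_n : \psi(x)=0\}$ has dimension less than $n-1$. That is, if $\psi_1$ and $\psi_2$ are real valued continuous functions lying in the eigenspaces of $T$ for eigenvalues $\lambda_1$ and $\lambda_2$ respectively, and $\dim N_{\psi_1}<n-1$ and $\dim N_{\psi_2}<n-1$, then $\lambda_1=\lambda_2$.
   Context: Manifolds are topological manifolds (without boundary). The measure $\mu$ is defined on the Borel subsets of $M_n$. A symmetric operator $T$ acting on a subspace $D\subseteq L_2(M_n,\mu)$ is a linear map $T:D\to L_2(M_n,\mu)$ with $\langle Tf,g\rangle=\langle f,Tg\rangle$ for all $f,g\in D$, where $\langle\cdot,\cdot\rangle$ is the $L_2$ inner product. The eigenspace of an eigenvalue $\lambda$ is $\{f\in D : Tf=\lambda f\}$. A continuous function is said to lie in an eigenspace if its class in $L_2(M_n,\mu)$ does. Dimension of a subset of $M_n$ means topological dimension in the sense of classical dimension theory of separable metrizable spaces, with the empty set having dimension $-1$. *)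

theory Defs
  imports "HOL-Analysis.Analysis"
begin

section \<open>Manifolds and dimension\<close>

definition topological_manifold :: "nat \<Rightarrow> 'a topology \<Rightarrow> bool" where
  "topological_manifold n X \<longleftrightarrow>
     Hausdorff_space X \<and>
     (\<forall>x\<in>topspace X. \<exists>U V. openin X U \<and> x \<in> U \<and> openin (Euclidean_space n) V \<and>
        subtopology X U homeomorphic_space subtopology (Euclidean_space n) V)"

text \<open>
  \<open>dim_le\<close> is the library's small inductive dimension, which on separable metrizable spaces
  agrees with the large inductive dimension and the covering dimension. The bound is an integer,
  and \<open>X dim_le k\<close> is false for \<open>k < -1\<close>.
\<close>

definition dim_less :: "'a topology \<Rightarrow> int \<Rightarrow> bool" where
  "dim_less X k \<longleftrightarrow> (\<exists>m<k. X dim_le m)"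

lemma dim_le_minus1_iff_empty: "X dim_le (-1) \<longleftrightarrow> topspace X = {}"
proof
  assume X: "X dim_le (-1)"
  show "topspace X = {}"
  proof (rule ccontr)
    assume "topspace X \<noteq> {}"
    then obtain a where "a \<in> topspace X" by blast
    with X obtain U where "subtopology X (X frontier_of U) dim_le (-1 - 1)"
      by (metis dimension_le.simps openin_topspace)
    then show False
      by (subst (asm) dimension_le.simps) simp
  qed
next
  assume "topspace X = {}"
  then show "X dim_le (-1)"
    by (subst dimension_le.simps) (auto dest: openin_subset)
qed

definition nodal_set :: "'a topology \<Rightarrow> ('a \<Rightarrow> real) \<Rightarrow> 'a set" where
  "nodal_set X \<psi> = {x \<in> topspace X. \<psi> x = 0}"

definition borel_measure_on :: "'a topology \<Rightarrow> 'a measure \<Rightarrow> bool" where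
  "borel_measure_on X \<mu> \<longleftrightarrow>
     space \<mu> = topspace X \<and> sets \<mu> = sigma_sets (topspace X) {U. openin X U}"


section \<open>The space \<open>L\<^sub>2\<close>\<close>

text \<open>
  The scalar field is either the reals or the complex numbers; the class below lets both be
  treated at once. Its axioms force \<open>scalar_cnj\<close> to be the identity on the reals.
\<close>

class l2_scalar = real_normed_field + banach + second_countable_topology +
  fixes scalar_cnj :: "'a \<Rightarrow> 'a"
  assumes scalar_cnj_add: "scalar_cnj (x + y) = scalar_cnj x + scalar_cnj y"
    and scalar_cnj_mult: "scalar_cnj (x * y) = scalar_cnj x * scalar_cnj y"
    and mult_scalar_cnj: "x * scalar_cnj x = ((norm x)\<^sup>2) *\<^sub>R 1"

instantiation real :: l2_scalar
begin
definition scalar_cnj_real :: "real \<Rightarrow> real" where "scalar_cnj_real x = x"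
instance by standard (simp_all add: scalar_cnj_real_def power2_eq_square)
end

instantiation complex :: l2_scalar
begin
definition scalar_cnj_complex :: "complex \<Rightarrow> complex" where "scalar_cnj_complex = cnj"
instance by standard (simp_all add: scalar_cnj_complex_def complex_norm_square[symmetric] scaleR_conv_of_real)
end

definition L2_fun :: "'a measure \<Rightarrow> ('a \<Rightarrow> 'k::l2_scalar) set" where
  "L2_fun \<mu> = {f \<in> borel_measurable \<mu>. integrable \<mu> (\<lambda>x. (norm (f x))\<^sup>2)}"

definition L2_rel :: "'a measure \<Rightarrow> (('a \<Rightarrow> 'k::l2_scalar) \<times> ('a \<Rightarrow> 'k)) set" where
  "L2_rel \<mu> = {(f, g). f \<in> L2_fun \<mu> \<and> g \<in> L2_fun \<mu> \<and> (AE x in \<mu>. f x = g x)}"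

definition L2 :: "'a measure \<Rightarrow> ('a \<Rightarrow> 'k::l2_scalar) set set" where
  "L2 \<mu> = L2_fun \<mu> // L2_rel \<mu>"

text \<open>For \<open>f\<close> outside \<open>L2_fun \<mu>\<close> the following is the empty set, which is not in \<open>L2 \<mu>\<close>.\<close>

definition L2_class :: "'a measure \<Rightarrow> ('a \<Rightarrow> 'k::l2_scalar) \<Rightarrow> ('a \<Rightarrow> 'k) set" where
  "L2_class \<mu> f = L2_rel \<mu> `` {f}"

definition L2_rep :: "('a \<Rightarrow> 'k::l2_scalar) set \<Rightarrow> 'a \<Rightarrow> 'k" where
  "L2_rep F = (SOME f. f \<in> F)"

definition L2_zero :: "'a measure \<Rightarrow> ('a \<Rightarrow> 'k::l2_scalar) set" where
  "L2_zero \<mu> = L2_class \<mu> (\<lambda>x. 0)"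

definition L2_add ::
  "'a measure \<Rightarrow> ('a \<Rightarrow> 'k::l2_scalar) set \<Rightarrow> ('a \<Rightarrow> 'k) set \<Rightarrow> ('a \<Rightarrow> 'k) set" where
  "L2_add \<mu> F G = L2_class \<mu> (\<lambda>x. L2_rep F x + L2_rep G x)"

definition L2_scale ::
  "'a measure \<Rightarrow> 'k::l2_scalar \<Rightarrow> ('a \<Rightarrow> 'k) set \<Rightarrow> ('a \<Rightarrow> 'k) set" where
  "L2_scale \<mu> c F = L2_class \<mu> (\<lambda>x. c * L2_rep F x)"

definition L2_inner ::
  "'a measure \<Rightarrow> ('a \<Rightarrow> 'k::l2_scalar) set \<Rightarrow> ('a \<Rightarrow> 'k) set \<Rightarrow> 'k" where
  "L2_inner \<mu> F G = (\<integral>x. L2_rep F x * scalar_cnj (L2_rep G x) \<partial>\<mu>)"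

text \<open>The operations do not depend on the chosen representatives.\<close>

lemma bounded_linear_scalar_cnj: "bounded_linear (scalar_cnj :: 'k::l2_scalar \<Rightarrow> 'k)"
proof -
  have 0: "scalar_cnj (0::'k) = 0"
    by (metis add_cancel_right_right scalar_cnj_add)
  have r: "scalar_cnj (of_real r :: 'k) = of_real r" for r
  proof (cases "r = 0")
    case False
    have "of_real r * scalar_cnj (of_real r :: 'k) = of_real r * of_real r"
      by (simp add: mult_scalar_cnj scaleR_conv_of_real power2_eq_square)
    with False show ?thesis by simp
  qed (simp add: 0)
  have n: "norm (scalar_cnj x) = norm x" for x :: 'k
  proof (cases "x = 0")
    case False
    have "norm x * norm (scalar_cnj x) = norm x * norm x"
      by (simp flip: norm_mult add: mult_scalar_cnj) (simp add: norm_mult power2_eq_square)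
    with False show ?thesis by simp
  qed (simp add: 0)
  show ?thesis
    by (rule bounded_linear_intro[where K = 1])
       (simp_all add: scalar_cnj_add scaleR_conv_of_real scalar_cnj_mult r n)
qed

lemma L2_fun_add:
  assumes "f \<in> L2_fun \<mu>" "g \<in> L2_fun \<mu>"
  shows "(\<lambda>x. f x + g x) \<in> L2_fun \<mu>"
proof -
  have [measurable]: "f \<in> borel_measurable \<mu>" "g \<in> borel_measurable \<mu>"
    using assms by (auto simp: L2_fun_def)
  have "integrable \<mu> (\<lambda>x. 2 * (norm (f x))\<^sup>2 + 2 * (norm (g x))\<^sup>2)"
    using assms by (auto simp: L2_fun_def)
  moreover have "(norm (f x + g x))\<^sup>2 \<le> 2 * (norm (f x))\<^sup>2 + 2 * (norm (g x))\<^sup>2" for x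
  proof -
    have "(norm (f x + g x))\<^sup>2 \<le> (norm (f x) + norm (g x))\<^sup>2"
      by (intro power_mono norm_triangle_ineq) simp
    also have "\<dots> \<le> 2 * (norm (f x))\<^sup>2 + 2 * (norm (g x))\<^sup>2"
      using sum_squares_bound[of "norm (f x)" "norm (g x)"] by (simp add: power2_sum)
    finally show ?thesis .
  qed
  ultimately have "integrable \<mu> (\<lambda>x. (norm (f x + g x))\<^sup>2)"
    by (elim Bochner_Integration.integrable_bound) auto
  then show ?thesis by (simp add: L2_fun_def)
qed

lemma L2_fun_scale: "f \<in> L2_fun \<mu> \<Longrightarrow> (\<lambda>x. c * f x) \<in> L2_fun \<mu>"
  by (auto simp: L2_fun_def norm_mult power_mult_distrib)

lemma equiv_L2_rel: "equiv (L2_fun \<mu>) (L2_rel \<mu>)"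
proof (rule equivI)
  show "sym (L2_rel \<mu>)" unfolding sym_def L2_rel_def by (auto simp: eq_commute)
  show "trans (L2_rel \<mu>)" unfolding trans_def L2_rel_def by auto
qed (auto simp: L2_rel_def refl_on_def)

lemma L2_class_eq_iff:
  "f \<in> L2_fun \<mu> \<Longrightarrow> g \<in> L2_fun \<mu> \<Longrightarrow> L2_class \<mu> f = L2_class \<mu> g \<longleftrightarrow> (AE x in \<mu>. f x = g x)"
  using eq_equiv_class_iff[OF equiv_L2_rel] by (auto simp: L2_class_def L2_rel_def)

lemma mem_L2_class_iff:
  "g \<in> L2_class \<mu> f \<longleftrightarrow> f \<in> L2_fun \<mu> \<and> g \<in> L2_fun \<mu> \<and> (AE x in \<mu>. f x = g x)"
  by (simp add: L2_class_def L2_rel_def)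

lemma L2_rep_class:
  assumes "f \<in> L2_fun \<mu>"
  shows "L2_rep (L2_class \<mu> f) \<in> L2_fun \<mu>" "AE x in \<mu>. f x = L2_rep (L2_class \<mu> f) x"
proof -
  have "f \<in> L2_class \<mu> f"
    using assms by (simp add: L2_class_def L2_rel_def)
  then have "L2_rep (L2_class \<mu> f) \<in> L2_class \<mu> f"
    unfolding L2_rep_def by (rule someI[where P = "\<lambda>h. h \<in> L2_class \<mu> f"])
  then show "L2_rep (L2_class \<mu> f) \<in> L2_fun \<mu>" "AE x in \<mu>. f x = L2_rep (L2_class \<mu> f) x"
    by (simp_all add: mem_L2_class_iff)
qed

lemma L2_add_class:
  assumes "f \<in> L2_fun \<mu>" "g \<in> L2_fun \<mu>"
  shows "L2_add \<mu> (L2_class \<mu> f) (L2_class \<mu> g) = L2_class \<mu> (\<lambda>x. f x + g x)"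
  unfolding L2_add_def using L2_rep_class[OF assms(1)] L2_rep_class[OF assms(2)] assms
  by (subst L2_class_eq_iff) (auto intro: L2_fun_add)

lemma L2_scale_class:
  assumes "f \<in> L2_fun \<mu>"
  shows "L2_scale \<mu> c (L2_class \<mu> f) = L2_class \<mu> (\<lambda>x. c * f x)"
  unfolding L2_scale_def using L2_rep_class[OF assms] assms
  by (subst L2_class_eq_iff) (auto intro: L2_fun_scale simp del: mult_cancel_left)

lemma L2_inner_class:
  assumes "f \<in> L2_fun \<mu>" "g \<in> L2_fun \<mu>"
  shows "L2_inner \<mu> (L2_class \<mu> f) (L2_class \<mu> g) = (\<integral>x. f x * scalar_cnj (g x) \<partial>\<mu>)"
proof -
  have c: "(\<lambda>x. scalar_cnj (h x)) \<in> borel_measurable \<mu>" if "h \<in> L2_fun \<mu>" for h :: "'a \<Rightarrow> 'b"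
    using that bounded_linear.continuous_on[OF bounded_linear_scalar_cnj continuous_on_id]
    by (auto simp: L2_fun_def intro: borel_measurable_continuous_on)
  show ?thesis
    unfolding L2_inner_def
    using L2_rep_class[OF assms(1)] L2_rep_class[OF assms(2)] assms
    by (intro integral_cong_AE borel_measurable_times c) (auto simp: L2_fun_def)
qed


section \<open>Symmetric operators\<close>

definition L2_subspace :: "'a measure \<Rightarrow> ('a \<Rightarrow> 'k::l2_scalar) set set \<Rightarrow> bool" where
  "L2_subspace \<mu> D \<longleftrightarrow> D \<subseteq> L2 \<mu> \<and> L2_zero \<mu> \<in> D \<and>
     (\<forall>F\<in>D. \<forall>G\<in>D. L2_add \<mu> F G \<in> D) \<and> (\<forall>c. \<forall>F\<in>D. L2_scale \<mu> c F \<in> D)"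

definition symmetric_operator ::
  "'a measure \<Rightarrow> ('a \<Rightarrow> 'k::l2_scalar) set set \<Rightarrow> (('a \<Rightarrow> 'k) set \<Rightarrow> ('a \<Rightarrow> 'k) set) \<Rightarrow> bool" where
  "symmetric_operator \<mu> D T \<longleftrightarrow> L2_subspace \<mu> D \<and> (\<forall>F\<in>D. T F \<in> L2 \<mu>) \<and>
     (\<forall>F\<in>D. \<forall>G\<in>D. T (L2_add \<mu> F G) = L2_add \<mu> (T F) (T G)) \<and>
     (\<forall>c. \<forall>F\<in>D. T (L2_scale \<mu> c F) = L2_scale \<mu> c (T F)) \<and>
     (\<forall>F\<in>D. \<forall>G\<in>D. L2_inner \<mu> (T F) G = L2_inner \<mu> F (T G))"

definition eigenspace ::
  "'a measure \<Rightarrow> ('a \<Rightarrow> 'k::l2_scalar) set set \<Rightarrow> (('a \<Rightarrow> 'k) set \<Rightarrow> ('a \<Rightarrow> 'k) set) \<Rightarrow> 'k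
     \<Rightarrow> ('a \<Rightarrow> 'k) set set" where
  "eigenspace \<mu> D T \<kappa> = {F \<in> D. T F = L2_scale \<mu> \<kappa> F}"

definition is_eigenvalue ::
  "'a measure \<Rightarrow> ('a \<Rightarrow> 'k::l2_scalar) set set \<Rightarrow> (('a \<Rightarrow> 'k) set \<Rightarrow> ('a \<Rightarrow> 'k) set) \<Rightarrow> 'k \<Rightarrow> bool" where
  "is_eigenvalue \<mu> D T \<kappa> \<longleftrightarrow> (\<exists>F\<in>eigenspace \<mu> D T \<kappa>. F \<noteq> L2_zero \<mu>)"

end

theory Submission
  imports Defs "HOL-Homology.Brouwer_Degree"
begin

text \<open>
  Eigenfunctions of a symmetric operator for different eigenvalues are orthogonal, so it suffices to
  see that \<open>\<psi>1\<close> and \<open>\<psi>2\<close> are not. A nodal set of dimension less than \<open>n - 1\<close> does not separate the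
  connected manifold; hence each \<open>\<psi>i\<close> has a constant sign
  (\<open>nodal_set_dim_le_imp_constant_sign\<close>), and so has the product \<open>\<psi>1 * \<psi>2\<close>. Its integral can only
  vanish if the product is zero everywhere, which would force one of the two nodal sets to contain a
  nonempty open set and thus to have too large a dimension (\<open>open_in_manifold_not_dim_le\<close>).

  The topological core is that, in a ball with coordinates \<open>0, ..., m\<close>, a closed set
  separating the poles has dimension at least \<open>m\<close> (\<open>separator_of_poles_not_dim_le\<close>). Small inductive
  dimension enters through one consequence (\<open>dim_le_imp_zeros_removable\<close>): on a compact set of
  dimension less than \<open>k\<close>, any \<open>k\<close> continuous real functions without common zero on a closed
  subset \<open>A\<close> can be changed off \<open>A\<close> so as to have no common zero at all. This property is additive over finite
  closed unions for trivial reasons, and it climbs from a partition between two sets to the whole space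
  when one more function is added (\<open>remove_zeros_across_partition\<close>), which gives the
  induction over the dimension. Applied to the coordinate functions on the
  boundary sphere and a partition of small dimension between the poles, the same step
  would extend the identity of the sphere to a map of the ball without zeros, contradicting the
  no-retraction theorem (\<open>extension_of_nsphere_identity_has_zero\<close>). Charts carry the result into the
  manifold: between two nearby points at which a function has opposite signs a small ball
  with these points as poles is embedded.
\<close>

section \<open>Removing common zeros over sets of small dimension\<close>

text \<open>
  A \<open>k\<close>-tuple of real functions without a common zero is, up to homotopy, a map into the sphere of
  dimension \<open>k - 1\<close>. So this is the classical description of \<open>dim K \<le> k - 1\<close> by extension of
  sphere-valued maps, written without spheres: keeping the coordinates separate allows each one to
  be extended by the Tietze theorem. All functions live on the ambient space \<open>X\<close>, so that several
  sets \<open>K\<close> can be treated one after the other. For \<open>k = 0\<close> there are no coordinates, and the property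
  says that \<open>K\<close> is empty.
\<close>

definition zeros_removable :: "'a topology \<Rightarrow> 'a set \<Rightarrow> nat \<Rightarrow> bool" where
  "zeros_removable X K k \<longleftrightarrow>
     (\<forall>A f. closedin X A \<longrightarrow> (\<forall>i<k. continuous_map X euclideanreal (f i)) \<longrightarrow>
        (\<forall>x\<in>A \<inter> K. \<exists>i<k. f i x \<noteq> 0) \<longrightarrow>
        (\<exists>g. (\<forall>i<k. continuous_map X euclideanreal (g i)) \<and> (\<forall>i<k. \<forall>x\<in>A. g i x = f i x) \<and>
             (\<forall>x\<in>K. \<exists>i<k. g i x \<noteq> (0::real))))"

lemma zeros_removableD:
  assumes "zeros_removable X K k" "closedin X A"
    and "\<And>i. i < k \<Longrightarrow> continuous_map X euclideanreal (f i)"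
    and "\<And>x. x \<in> A \<Longrightarrow> x \<in> K \<Longrightarrow> \<exists>i<k. f i x \<noteq> 0"
  obtains g where "\<And>i. i < k \<Longrightarrow> continuous_map X euclideanreal (g i)"
    "\<And>i x. i < k \<Longrightarrow> x \<in> A \<Longrightarrow> g i x = f i x" "\<And>x. x \<in> K \<Longrightarrow> \<exists>i<k. g i x \<noteq> (0::real)"
proof -
  have "\<forall>i<k. continuous_map X euclideanreal (f i)" "\<forall>x\<in>A \<inter> K. \<exists>i<k. f i x \<noteq> 0"
    using assms(3,4) by auto
  with assms(1,2) have "\<exists>g. (\<forall>i<k. continuous_map X euclideanreal (g i)) \<and>
      (\<forall>i<k. \<forall>x\<in>A. g i x = f i x) \<and> (\<forall>x\<in>K. \<exists>i<k. g i x \<noteq> 0)"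
    unfolding zeros_removable_def by simp
  then obtain g where "\<forall>i<k. continuous_map X euclideanreal (g i)"
      "\<forall>i<k. \<forall>x\<in>A. g i x = f i x" "\<forall>x\<in>K. \<exists>i<k. g i x \<noteq> 0"
    by (elim exE conjE)
  then show thesis by (intro that[of g]) auto
qed

lemma Tietze_extension_Un:
  fixes f g :: "'a \<Rightarrow> real"
  assumes X: "normal_space X" and S: "closedin X S" and T: "closedin X T"
    and f: "continuous_map X euclideanreal f" and g: "continuous_map X euclideanreal g"
    and eq: "\<And>x. x \<in> S \<Longrightarrow> x \<in> T \<Longrightarrow> f x = g x"
  obtains h where "continuous_map X euclideanreal h"
    "\<And>x. x \<in> S \<Longrightarrow> h x = f x" "\<And>x. x \<in> T \<Longrightarrow> h x = g x"
proof -
  let ?Y = "subtopology X (S \<union> T)"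
  define p where "p x = (if x \<in> S then f x else g x)" for x
  have "continuous_map ?Y euclideanreal p"
  proof (rule pasting_lemma_closed[where I = "UNIV :: bool set"
        and T = "\<lambda>b. if b then S else T" and f = "\<lambda>b. if b then f else g"])
    show "closedin ?Y (if b then S else T)" for b
      using S T by (auto intro!: closedin_subset_topspace)
    show "continuous_map (subtopology ?Y (if b then S else T)) euclideanreal (if b then f else g)" for b
      using f g by (auto intro: continuous_map_from_subtopology)
    show "\<exists>j. j \<in> UNIV \<and> x \<in> (if j then S else T) \<and> p x = (if j then f else g) x"
      if "x \<in> topspace ?Y" for x
    proof (cases "x \<in> S")
      case True then show ?thesis by (intro exI[of _ True]) (simp add: p_def)
    next
      case False with that show ?thesis by (intro exI[of _ False]) (simp add: p_def)
    qed
  qed (auto simp: eq split: if_splits)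
  moreover have "closedin X (S \<union> T)"
    using S T by (rule closedin_Un)
  ultimately obtain h where "continuous_map X euclideanreal h" "\<And>x. x \<in> S \<union> T \<Longrightarrow> h x = p x"
    using X normal_space_iff_Tietze by metis
  with eq show thesis by (intro that[of h]) (auto simp: p_def)
qed

lemma zeros_removable_empty: "zeros_removable X {} k"
  unfolding zeros_removable_def by blast

text \<open>
  This is what makes the property easier to handle than the inductive dimension, for which a sum
  theorem is laborious: remove the zeros on \<open>K\<close> first, and then those on \<open>L\<close> while keeping the
  functions fixed on \<open>A \<union> K\<close>.
\<close>

lemma zeros_removable_Un:
  assumes "closedin X K" and K: "zeros_removable X K k" and L: "zeros_removable X L k"
  shows "zeros_removable X (K \<union> L) k"
  unfolding zeros_removable_def
proof (intro allI impI)
  fix A and f :: "nat \<Rightarrow> 'a \<Rightarrow> real"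
  assume A: "closedin X A" and f: "\<forall>i<k. continuous_map X euclideanreal (f i)"
    and nz: "\<forall>x\<in>A \<inter> (K \<union> L). \<exists>i<k. f i x \<noteq> 0"
  obtain g where g: "\<And>i. i < k \<Longrightarrow> continuous_map X euclideanreal (g i)"
      "\<And>i x. i < k \<Longrightarrow> x \<in> A \<Longrightarrow> g i x = f i x" "\<And>x. x \<in> K \<Longrightarrow> \<exists>i<k. g i x \<noteq> 0"
    using zeros_removableD[OF K A, of f] f nz by blast
  have "\<exists>i<k. g i x \<noteq> 0" if "x \<in> A \<union> K" "x \<in> L" for x
    using that g(2,3) nz by (metis IntI UnE UnI2)
  then obtain h where h: "\<And>i. i < k \<Longrightarrow> continuous_map X euclideanreal (h i)"
      "\<And>i x. i < k \<Longrightarrow> x \<in> A \<union> K \<Longrightarrow> h i x = g i x" "\<And>x. x \<in> L \<Longrightarrow> \<exists>i<k. h i x \<noteq> 0"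
    using zeros_removableD[OF L closedin_Un[OF A \<open>closedin X K\<close>], of g] g(1) by blast
  show "\<exists>g. (\<forall>i<k. continuous_map X euclideanreal (g i)) \<and> (\<forall>i<k. \<forall>x\<in>A. g i x = f i x) \<and>
          (\<forall>x\<in>K \<union> L. \<exists>i<k. g i x \<noteq> 0)"
    by (rule exI[of _ h]) (metis UnE UnI1 UnI2 g(2,3) h)
qed

lemma zeros_removable_UN:
  assumes "finite I" "\<And>i. i \<in> I \<Longrightarrow> closedin X (K i)" "\<And>i. i \<in> I \<Longrightarrow> zeros_removable X (K i) k"
  shows "zeros_removable X (\<Union>i\<in>I. K i) k"
  using assms by (induction I rule: finite_induct) (auto intro: zeros_removable_empty zeros_removable_Un)

lemma zeros_removable_subset:
  assumes X: "normal_space X" and K: "closedin X K" "zeros_removable X K k"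
    and L: "closedin X L" "L \<subseteq> K"
  shows "zeros_removable X L k"
  unfolding zeros_removable_def
proof (intro allI impI)
  fix A and f :: "nat \<Rightarrow> 'a \<Rightarrow> real"
  assume A: "closedin X A" and f: "\<forall>i<k. continuous_map X euclideanreal (f i)"
    and nz: "\<forall>x\<in>A \<inter> L. \<exists>i<k. f i x \<noteq> 0"
  obtain g where g: "\<And>i. i < k \<Longrightarrow> continuous_map X euclideanreal (g i)"
      "\<And>i x. i < k \<Longrightarrow> x \<in> A \<inter> L \<Longrightarrow> g i x = f i x" "\<And>x. x \<in> K \<Longrightarrow> \<exists>i<k. g i x \<noteq> 0"
    using zeros_removableD[OF K(2) closedin_Int[OF A L(1)], of f] f nz by blast
  have "\<exists>h. continuous_map X euclideanreal h \<and> (\<forall>x\<in>A. h x = f i x) \<and> (\<forall>x\<in>L. h x = g i x)"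
    if "i < k" for i
    by (rule Tietze_extension_Un[OF X A L(1), of "f i" "g i"]) (use f g that in auto)
  then obtain h where "\<And>i. i < k \<Longrightarrow>
      continuous_map X euclideanreal (h i) \<and> (\<forall>x\<in>A. h i x = f i x) \<and> (\<forall>x\<in>L. h i x = g i x)"
    by metis
  with g(3) L(2) show "\<exists>g. (\<forall>i<k. continuous_map X euclideanreal (g i)) \<and>
      (\<forall>i<k. \<forall>x\<in>A. g i x = f i x) \<and> (\<forall>x\<in>L. \<exists>i<k. g i x \<noteq> 0)"
    by (intro exI[of _ h]) (metis subsetD)
qed

text \<open>
  The step from \<open>k\<close> to \<open>k + 1\<close> functions. The set \<open>C \<inter> E\<close> is a partition of \<open>C \<union> E\<close>; the hypotheses say
  that it separates those common zeros of the first \<open>k\<close> functions in \<open>A\<close> at which the last function is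
  positive (they lie in \<open>C\<close>) from those at which it is negative (they lie in \<open>E\<close>). Once the first \<open>k\<close>
  functions have been changed to have no common zero on the partition, their common zeros on
  \<open>C \<union> E\<close> fall into two disjoint closed parts, and the last function can be made positive on one
  and negative on the other.
\<close>

lemma remove_zeros_across_partition:
  fixes f :: "nat \<Rightarrow> 'a \<Rightarrow> real"
  assumes X: "normal_space X" and C: "closedin X C" and E: "closedin X E"
    and CE: "zeros_removable X (C \<inter> E) k" and A: "closedin X A"
    and f: "\<And>i. i \<le> k \<Longrightarrow> continuous_map X euclideanreal (f i)"
    and pos: "\<And>x. x \<in> A \<Longrightarrow> x \<in> C \<Longrightarrow> (\<And>i. i < k \<Longrightarrow> f i x = 0) \<Longrightarrow> f k x > 0"
    and neg: "\<And>x. x \<in> A \<Longrightarrow> x \<in> E \<Longrightarrow> (\<And>i. i < k \<Longrightarrow> f i x = 0) \<Longrightarrow> f k x < 0"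
  obtains g where "\<And>i. i \<le> k \<Longrightarrow> continuous_map X euclideanreal (g i)"
    "\<And>i x. i \<le> k \<Longrightarrow> x \<in> A \<Longrightarrow> g i x = f i x" "\<And>x. x \<in> C \<union> E \<Longrightarrow> \<exists>i\<le>k. g i x \<noteq> (0::real)"
proof -
  have "\<exists>i<k. f i x \<noteq> 0" if "x \<in> A" "x \<in> C \<inter> E" for x
  proof (rule ccontr)
    assume "\<not> (\<exists>i<k. f i x \<noteq> 0)"
    then have "f i x = 0" if "i < k" for i using that by blast
    with that have "f k x > 0" and "f k x < 0"
      using pos[of x] neg[of x] by blast+
    then show False by simp
  qed
  then obtain g where g: "\<And>i. i < k \<Longrightarrow> continuous_map X euclideanreal (g i)"
      "\<And>i x. i < k \<Longrightarrow> x \<in> A \<Longrightarrow> g i x = f i x" "\<And>x. x \<in> C \<inter> E \<Longrightarrow> \<exists>i<k. g i x \<noteq> 0"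
    using zeros_removableD[OF CE A, of f] f less_imp_le by blast
  define Z where "Z = {x \<in> topspace X. \<forall>i<k. g i x = 0}"
  have "Z = topspace X \<inter> (\<Inter>i\<in>{..<k}. {x \<in> topspace X. g i x \<in> {0}})"
    by (auto simp: Z_def)
  moreover have "closedin X {x \<in> topspace X. g i x \<in> {0}}" if "i < k" for i
    using g(1)[OF that] by (rule closedin_continuous_map_preimage) simp
  ultimately have Z: "closedin X Z"
    by (cases "k = 0") (auto simp: lessThan_empty_iff intro!: closedin_Int closedin_INT)
  have disj: "Z \<inter> C \<inter> (Z \<inter> E) = {}"
    using g(3) by (force simp: Z_def)
  have fk: "continuous_map (subtopology X S) euclideanreal (f k)" for S
    using f[of k] by (simp add: continuous_map_from_subtopology)
  have fpos: "f k x > 0" if "x \<in> A" "x \<in> Z" "x \<in> C" for x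
    using that g(2) by (intro pos) (auto simp: Z_def)
  have fneg: "f k x < 0" if "x \<in> A" "x \<in> Z" "x \<in> E" for x
    using that g(2) by (intro neg) (auto simp: Z_def)
  \<comment> \<open>\<open>p\<close> and \<open>q\<close> carry the two signs off \<open>A\<close>; \<open>r\<close> joins them, and \<open>h\<close> joins \<open>r\<close> to the given values on \<open>A\<close>\<close>
  obtain p where p: "continuous_map X euclideanreal p" "p ` topspace X \<subseteq> {0<..}"
      "\<And>x. x \<in> A \<inter> (Z \<inter> C) \<Longrightarrow> p x = f k x"
    by (rule Tietze_extension_realinterval[of X "A \<inter> (Z \<inter> C)" "{0<..}" "f k"])
      (use X A Z C fk fpos in \<open>auto intro: is_interval_oi gt_ex\<close>)
  obtain q where q: "continuous_map X euclideanreal q" "q ` topspace X \<subseteq> {..<0}"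
      "\<And>x. x \<in> A \<inter> (Z \<inter> E) \<Longrightarrow> q x = f k x"
    by (rule Tietze_extension_realinterval[of X "A \<inter> (Z \<inter> E)" "{..<0}" "f k"])
      (use X A Z E fk fneg in \<open>auto intro: is_interval_io lt_ex\<close>)
  obtain r where r: "continuous_map X euclideanreal r"
      "\<And>x. x \<in> Z \<inter> C \<Longrightarrow> r x = p x" "\<And>x. x \<in> Z \<inter> E \<Longrightarrow> r x = q x"
    by (rule Tietze_extension_Un[of X "Z \<inter> C" "Z \<inter> E" p q])
      (use X Z C E p(1) q(1) disj in auto)
  obtain h where h: "continuous_map X euclideanreal h"
      "\<And>x. x \<in> A \<Longrightarrow> h x = f k x" "\<And>x. x \<in> Z \<inter> (C \<union> E) \<Longrightarrow> h x = r x"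
    by (rule Tietze_extension_Un[of X A "Z \<inter> (C \<union> E)" "f k" r])
      (use X A Z C E f[of k] r p(3) q(3) in \<open>auto intro: closedin_Un\<close>)
  have hnz: "h x \<noteq> 0" if "x \<in> Z" "x \<in> C \<union> E" for x
  proof (cases "x \<in> C")
    case True
    then have "h x = p x" using that h(3) r(2) by auto
    then show ?thesis using p(2) that(1) by (force simp: Z_def)
  next
    case False
    then have "h x = q x" using that h(3) r(3) by auto
    then show ?thesis using q(2) that(1) by (force simp: Z_def)
  qed
  show thesis
  proof (rule that[of "g(k := h)"])
    show "continuous_map X euclideanreal ((g(k := h)) i)" if "i \<le> k" for i
      using that g(1) h(1) by auto
    show "(g(k := h)) i x = f i x" if "i \<le> k" "x \<in> A" for i x
      using that g(2) h(2) by auto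
    show "\<exists>i\<le>k. (g(k := h)) i x \<noteq> 0" if "x \<in> C \<union> E" for x
    proof (cases "x \<in> Z")
      case True
      then show ?thesis using hnz that by (intro exI[of _ k]) auto
    next
      case False
      moreover have "x \<in> topspace X"
        using that C E closedin_subset by blast
      ultimately obtain i where "i < k" "g i x \<noteq> 0" by (auto simp: Z_def)
      then show ?thesis by (intro exI[of _ i]) auto
    qed
  qed
qed

text \<open>
  Induction on \<open>k\<close>. To apply the preceding step, the sets \<open>P\<close> and \<open>N\<close> of common zeros of the first \<open>k\<close>
  functions at which the last one is positive or negative must be separated in \<open>K\<close>. Each
  point of \<open>P\<close> has a neighbourhood away from \<open>N\<close> with frontier of dimension one less; finitely many
  of them cover \<open>P\<close>, and the frontier of their union lies in the union of their frontiers, where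
  zeros are removable by the induction hypothesis.
\<close>

lemma dim_le_imp_zeros_removable:
  assumes X: "compact_space X" "Hausdorff_space X"
    and "closedin X K" "subtopology X K dim_le int k - 1"
  shows "zeros_removable X K k"
  using assms(3,4)
proof (induction k arbitrary: K)
  case 0
  then have "topspace (subtopology X K) = {}"
    using dim_le_minus1_iff_empty[of "subtopology X K"] by simp
  with closedin_subset[OF 0(1)] have "K = {}"
    by auto
  then show ?case by (simp add: zeros_removable_empty)
next
  case (Suc k)
  let ?Y = "subtopology X K"
  have normal: "normal_space X"
    using X by (simp add: compact_Hausdorff_or_regular_imp_normal_space)
  have tY: "topspace ?Y = K"
    using closedin_subset[OF Suc.prems(1)] by auto
  have cY: "closedin X S" if "closedin ?Y S" for S
    using that Suc.prems(1) closedin_trans_full by blast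
  have compY: "compact_space ?Y"
    using X Suc.prems(1) closedin_compact_space compact_space_subtopology by blast
  have regY: "regular_space ?Y"
    using X compY by (simp add: compact_Hausdorff_imp_regular_space Hausdorff_space_subtopology)
  show ?case
    unfolding zeros_removable_def
  proof (intro allI impI)
    fix A and f :: "nat \<Rightarrow> 'a \<Rightarrow> real"
    assume A: "closedin X A" and f: "\<forall>i<Suc k. continuous_map X euclideanreal (f i)"
      and nz: "\<forall>x\<in>A \<inter> K. \<exists>i<Suc k. f i x \<noteq> 0"
    \<comment> \<open>the last function does not vanish on either set, so the weak inequalities, which make the sets visibly closed, are strict there\<close>
    define P where "P = {x \<in> A \<inter> K. (\<forall>i<k. f i x = 0) \<and> f k x \<ge> 0}"
    define N where "N = {x \<in> A \<inter> K. (\<forall>i<k. f i x = 0) \<and> f k x \<le> 0}"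
    have zero: "closedin X {x \<in> topspace X. f i x \<in> T}" if "i \<le> k" "closed T" for i T
      using f that by (intro closedin_continuous_map_preimage[where Y = euclideanreal]) auto
    have AK: "closedin X (A \<inter> K)" "A \<inter> K \<subseteq> topspace X"
      using A Suc.prems(1) closedin_subset by auto
    have "P = A \<inter> K \<inter> {x \<in> topspace X. f k x \<in> {0..}} \<inter> (A \<inter> K \<inter> (\<Inter>i\<in>{..<k}. {x \<in> topspace X. f i x \<in> {0}}))"
      "N = A \<inter> K \<inter> {x \<in> topspace X. f k x \<in> {..0}} \<inter> (A \<inter> K \<inter> (\<Inter>i\<in>{..<k}. {x \<in> topspace X. f i x \<in> {0}}))"
      using AK(2) by (auto simp: P_def N_def)
    moreover have "closedin X (A \<inter> K \<inter> (\<Inter>i\<in>{..<k}. {x \<in> topspace X. f i x \<in> {0}}))"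
      using AK(1) zero[of _ "{0}"]
      by (cases "k = 0") (auto simp: lessThan_empty_iff intro!: closedin_Int closedin_INT)
    ultimately have clo: "closedin X P" "closedin X N"
      using AK(1) zero[of k "{0..}"] zero[of k "{..0}"] by (auto intro: closedin_Int)
    have disj: "P \<inter> N = {}"
      using nz by (force simp: P_def N_def less_Suc_eq)
    have "\<exists>U. a \<in> U \<and> openin ?Y U \<and> ?Y closure_of U \<inter> N = {} \<and> subtopology X (?Y frontier_of U) dim_le int k - 1"
      if "a \<in> P" for a
    proof -
      have aK: "a \<in> topspace ?Y - N" and "closedin ?Y N"
        using that disj tY clo(2) by (auto simp: P_def N_def intro!: closedin_subset_topspace)
      then obtain V where V: "openin ?Y V" "a \<in> V" "disjnt N (?Y closure_of V)"
        using regY unfolding regular_space by metis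
      then obtain U where U: "a \<in> U" "U \<subseteq> V" "openin ?Y U"
          "subtopology ?Y (?Y frontier_of U) dim_le int (Suc k) - 1 - 1"
        using Suc.prems(2) by (metis dimension_le.cases)
      moreover have "subtopology ?Y (?Y frontier_of U) = subtopology X (?Y frontier_of U)"
        using frontier_of_subset_topspace[of ?Y U] tY by (simp add: subtopology_subtopology Int_absorb1)
      moreover have "?Y closure_of U \<inter> N = {}"
        using V(3) closure_of_mono[OF U(2), of ?Y] by (auto simp: disjnt_iff)
      ultimately show ?thesis by (intro exI[of _ U]) auto
    qed
    then obtain U where U: "\<And>a. a \<in> P \<Longrightarrow> a \<in> U a" "\<And>a. a \<in> P \<Longrightarrow> openin ?Y (U a)"
        "\<And>a. a \<in> P \<Longrightarrow> ?Y closure_of (U a) \<inter> N = {}"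
        "\<And>a. a \<in> P \<Longrightarrow> subtopology X (?Y frontier_of (U a)) dim_le int k - 1"
      by metis
    have "closedin ?Y P"
      using clo(1) by (auto simp: P_def intro!: closedin_subset_topspace)
    then have "compactin ?Y P"
      using compY closedin_compact_space by blast
    moreover have "Ball (U ` P) (openin ?Y)" "P \<subseteq> \<Union>(U ` P)"
      using U(1,2) by auto
    ultimately obtain \<F> where \<F>: "finite \<F>" "\<F> \<subseteq> U ` P" "P \<subseteq> \<Union>\<F>"
      unfolding compactin_def by meson
    obtain F where F: "finite F" "F \<subseteq> P" "\<F> = U ` F"
      using finite_subset_image[OF \<F>(1,2)] by blast
    with \<F>(3) have F: "finite F" "F \<subseteq> P" "P \<subseteq> (\<Union>a\<in>F. U a)"
      by auto
    define C where "C = (\<Union>a\<in>F. ?Y closure_of (U a))"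
    define E where "E = topspace ?Y - (\<Union>a\<in>F. U a)"
    have C: "closedin X C"
      unfolding C_def using F(1) by (intro closedin_Union cY) auto
    have E: "closedin X E"
      unfolding E_def using F U(2) by (intro cY closedin_diff closedin_topspace openin_Union) blast
    have fr: "closedin X (\<Union>a\<in>F. ?Y frontier_of (U a))"
      using F(1) by (intro closedin_Union cY) (auto simp: closedin_frontier_of)
    have "zeros_removable X (\<Union>a\<in>F. ?Y frontier_of (U a)) k"
      using F U(4) by (intro zeros_removable_UN Suc.IH cY closedin_frontier_of) auto
    moreover have "C \<inter> E \<subseteq> (\<Union>a\<in>F. ?Y frontier_of (U a))"
      using F(2) U(2) by (auto simp: C_def E_def frontier_of_def interior_of_openin subset_iff)
    ultimately have CE: "zeros_removable X (C \<inter> E) k"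
      using normal fr C E by (meson zeros_removable_subset closedin_Int)
    have KCE: "C \<union> E = K"
    proof -
      have "U a \<subseteq> ?Y closure_of (U a)" if "a \<in> F" for a
        using F(2) U(2) that openin_subset closure_of_subset by (metis subsetD)
      moreover have "?Y closure_of (U a) \<subseteq> K" for a
        using closure_of_subset_topspace[of ?Y] tY by auto
      ultimately show ?thesis unfolding C_def E_def tY by fast
    qed
    have nz': "f k x \<noteq> 0" if "x \<in> A" "x \<in> K" "\<And>i. i < k \<Longrightarrow> f i x = 0" for x
      using nz that by (metis IntI less_Suc_eq)
    obtain g where "\<And>i. i \<le> k \<Longrightarrow> continuous_map X euclideanreal (g i)"
      "\<And>i x. i \<le> k \<Longrightarrow> x \<in> A \<Longrightarrow> g i x = f i x" "\<And>x. x \<in> C \<union> E \<Longrightarrow> \<exists>i\<le>k. g i x \<noteq> 0"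
    proof (rule remove_zeros_across_partition[OF normal C E CE A, of f])
      fix x assume x: "x \<in> A" "\<And>i. i < k \<Longrightarrow> f i x = 0"
      show "f k x > 0" if "x \<in> C"
      proof -
        have "x \<notin> N" using that U(3) F(2) by (auto simp: C_def)
        then show ?thesis using x that KCE by (force simp: N_def)
      qed
      show "f k x < 0" if "x \<in> E"
      proof -
        have "x \<notin> P" using that F(3) by (auto simp: E_def)
        then show ?thesis using x that KCE by (force simp: P_def)
      qed
    qed (use f in auto)
    then show "\<exists>g. (\<forall>i<Suc k. continuous_map X euclideanreal (g i)) \<and>
       (\<forall>i<Suc k. \<forall>x\<in>A. g i x = f i x) \<and> (\<forall>x\<in>K. \<exists>i<Suc k. g i x \<noteq> 0)"
      unfolding KCE less_Suc_eq_le by blast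
  qed
qed

section \<open>Separating the poles of a ball\<close>

definition nball :: "nat \<Rightarrow> (nat \<Rightarrow> real) topology" where
  "nball m = subtopology (Euclidean_space (Suc m)) {x. (\<Sum>i\<le>m. (x i)\<^sup>2) \<le> 1}"

lemma nball:
  "nball m = subtopology (powertop_real UNIV) {x. (\<Sum>i\<le>m. (x i)\<^sup>2) \<le> 1 \<and> (\<forall>i>m. x i = 0)}"
  by (simp add: nball_def Euclidean_space_def subtopology_subtopology Suc_le_eq Collect_conj_eq Int_commute)

lemma topspace_nball: "topspace (nball m) = {x. (\<Sum>i\<le>m. (x i)\<^sup>2) \<le> 1 \<and> (\<forall>i>m. x i = 0)}"
  by (simp add: nball)

lemma topspace_nsphere: "topspace (nsphere m) = {x. (\<Sum>i\<le>m. (x i)\<^sup>2) = 1 \<and> (\<forall>i>m. x i = 0)}"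
  by (simp add: nsphere)

lemma abs_coord_le_1:
  assumes "x \<in> topspace (nball m)"
  shows "\<bar>x i\<bar> \<le> 1"
proof (cases "i \<le> m")
  case True
  then have "(x i)\<^sup>2 \<le> (\<Sum>i\<le>m. (x i)\<^sup>2)"
    by (intro member_le_sum) auto
  with assms have "(x i)\<^sup>2 \<le> 1" by (simp add: topspace_nball)
  then show ?thesis by (simp add: abs_square_le_1)
qed (use assms in \<open>simp add: topspace_nball\<close>)

lemma continuous_map_nball_projection: "continuous_map (nball m) euclideanreal (\<lambda>x. x k)"
  unfolding nball by (intro continuous_map_from_subtopology continuous_map_product_projection) auto

lemma Hausdorff_nball: "Hausdorff_space (nball m)"
  unfolding nball_def by (intro Hausdorff_space_subtopology Hausdorff_Euclidean_space)

lemma closedin_nball_real: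
  assumes "continuous_map (nball m) euclideanreal f" "closed T"
  shows "closedin (nball m) {x \<in> topspace (nball m). f x \<in> T}"
  using assms by (intro closedin_continuous_map_preimage[where Y = euclideanreal]) auto

lemma compact_nball: "compact_space (nball m)"
proof -
  let ?P = "powertop_real (UNIV :: nat set)"
  let ?s = "\<lambda>x :: nat \<Rightarrow> real. \<Sum>i\<le>m. (x i)\<^sup>2"
  have proj: "continuous_map ?P euclideanreal (\<lambda>x. x i)" for i
    by (rule continuous_map_product_projection) simp
  have "closedin ?P {x \<in> topspace ?P. ?s x \<in> {..1}}"
    by (intro closedin_continuous_map_preimage[where Y = euclideanreal] continuous_map_sum
        continuous_map_real_pow proj) auto
  moreover have "closedin ?P {x \<in> topspace ?P. x i \<in> {0}}" for i
    by (intro closedin_continuous_map_preimage[where Y = euclideanreal] proj) auto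
  then have "closedin ?P (\<Inter>i\<in>{m<..}. {x \<in> topspace ?P. x i \<in> {0}})"
    by (intro closedin_INT) auto
  ultimately have "closedin ?P ({x \<in> topspace ?P. ?s x \<in> {..1}} \<inter> (\<Inter>i\<in>{m<..}. {x \<in> topspace ?P. x i \<in> {0}}))"
    by (rule closedin_Int)
  also have "{x \<in> topspace ?P. ?s x \<in> {..1}} \<inter> (\<Inter>i\<in>{m<..}. {x \<in> topspace ?P. x i \<in> {0}}) = topspace (nball m)"
    by (auto simp: topspace_nball)
  finally have clo: "closedin ?P (topspace (nball m))" .
  have "compactin ?P (PiE UNIV (\<lambda>i. {-1..1}))"
    by (simp add: compactin_PiE)
  moreover have "topspace (nball m) \<subseteq> PiE UNIV (\<lambda>i. {-1..1})"
    using abs_coord_le_1[of _ m] by (fastforce simp: abs_le_iff)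
  ultimately have "compactin ?P (topspace (nball m))"
    using clo closed_compactin by blast
  then show ?thesis
    unfolding nball by (simp add: compact_space_subtopology)
qed

lemma contractible_nball: "contractible_space (nball m)"
proof -
  let ?D = "nball m" and ?h = "\<lambda>(t :: real, x :: nat \<Rightarrow> real) i. (1 - t) * x i"
  let ?X = "prod_topology (top_of_set {0..1}) ?D"
  have "continuous_map ?X euclideanreal (\<lambda>p. ?h p i)" for i
  proof -
    have "continuous_map ?X euclideanreal (\<lambda>p. snd p i)" "continuous_map ?X euclideanreal fst"
      using continuous_map_compose[OF continuous_map_snd continuous_map_nball_projection]
        continuous_map_fst[of "top_of_set {0..1::real}" ?D]
      by (auto simp: o_def continuous_map_in_subtopology)
    then have "continuous_map ?X euclideanreal (\<lambda>p. (1 - fst p) * snd p i)"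
      by (intro continuous_map_real_mult continuous_map_diff) auto
    then show ?thesis by (simp add: case_prod_unfold)
  qed
  moreover have "?h (t, x) \<in> topspace ?D" if "0 \<le> t" "t \<le> 1" "x \<in> topspace ?D" for t x
  proof -
    have "(\<Sum>i\<le>m. ((1 - t) * x i)\<^sup>2) = (1 - t)\<^sup>2 * (\<Sum>i\<le>m. (x i)\<^sup>2)"
      by (simp add: power_mult_distrib sum_distrib_left)
    also have "\<dots> \<le> 1 * 1"
      using that by (intro mult_mono power_le_one sum_nonneg) (auto simp: topspace_nball)
    finally show ?thesis using that(3) by (simp add: topspace_nball)
  qed
  ultimately have "continuous_map ?X ?D ?h"
    unfolding nball continuous_map_in_subtopology continuous_map_componentwise_UNIV
    by (auto simp: topspace_nball)
  then have "homotopic_with (\<lambda>x. True) ?D ?D id (\<lambda>x i. 0)"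
    unfolding homotopic_with_def by (intro exI[of _ ?h]) (auto simp: fun_eq_iff)
  then show ?thesis
    unfolding contractible_space_def by blast
qed

text \<open>
  Brouwer's no-retraction theorem: normalizing an extension without zeros would retract the
  contractible ball onto its boundary sphere.
\<close>

lemma extension_of_nsphere_identity_has_zero:
  assumes g: "\<And>i. i \<le> m \<Longrightarrow> continuous_map (nball m) euclideanreal (g i)"
    and id: "\<And>x i. x \<in> topspace (nsphere m) \<Longrightarrow> i \<le> m \<Longrightarrow> g i x = x i"
  shows "\<exists>x\<in>topspace (nball m). \<forall>i\<le>m. g i x = 0"
proof (rule ccontr)
  assume "\<not> ?thesis"
  then have nz: "\<exists>i\<le>m. g i x \<noteq> 0" if "x \<in> topspace (nball m)" for x
    using that by blast
  define s where "s x = (\<Sum>j\<le>m. (g j x)\<^sup>2)" for x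
  have pos: "s x > 0" if "x \<in> topspace (nball m)" for x
  proof -
    from nz[OF that] obtain i where "i \<le> m" "g i x \<noteq> 0" by blast
    then show ?thesis unfolding s_def by (intro sum_pos2[of _ i]) auto
  qed
  define r where "r x = (\<lambda>i. if i \<le> m then g i x / sqrt (s x) else 0)" for x
  have "continuous_map (nball m) euclideanreal (\<lambda>x. sqrt (s x))"
    unfolding s_def using g
    by (intro continuous_map_sqrt continuous_map_sum continuous_map_real_pow) auto
  then have "continuous_map (nball m) euclideanreal (\<lambda>x. r x i)" for i
    using g pos by (cases "i \<le> m") (force simp: r_def intro!: continuous_map_real_divide)+
  moreover have "r x \<in> topspace (nsphere m)" if "x \<in> topspace (nball m)" for x
  proof -
    have "(\<Sum>i\<le>m. (r x i)\<^sup>2) = s x / s x"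
      unfolding s_def using pos[OF that]
      by (simp add: r_def power_divide s_def flip: sum_divide_distrib)
    then show ?thesis using pos[OF that] by (simp add: topspace_nsphere r_def)
  qed
  ultimately have "continuous_map (nball m) (nsphere m) r"
    unfolding nsphere continuous_map_in_subtopology continuous_map_componentwise_UNIV
    by (auto simp: topspace_nsphere)
  moreover have "continuous_map (nsphere m) (nball m) id"
    unfolding nball continuous_map_in_subtopology continuous_map_componentwise_UNIV
    by (auto simp: topspace_nsphere continuous_map_nsphere_projection)
  moreover have "r x = x" if "x \<in> topspace (nsphere m)" for x
  proof -
    have "s x = 1"
      using that id[OF that] by (simp add: s_def topspace_nsphere)
    then show ?thesis
      using that id[OF that] by (auto simp: r_def topspace_nsphere fun_eq_iff)
  qed
  ultimately have "retraction_map (nball m) (nsphere m) r"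
    unfolding retraction_map_def retraction_maps_def by (intro exI[of _ id]) auto
  then show False
    using contractible_space_retraction_map_image contractible_nball non_contractible_space_nsphere
    by blast
qed

text \<open>
  If the zero set of \<open>\<phi>\<close> had dimension less than \<open>m\<close>, it would be a partition on which the zeros
  of \<open>m\<close> functions are removable. Take the coordinate functions on the boundary sphere: the first \<open>m\<close> of
  them vanish together only at the two poles, which the partition separates. Hence the identity
  of the sphere would extend to the ball without a zero.
\<close>

lemma separator_of_poles_not_dim_le:
  assumes \<phi>: "continuous_map (nball m) euclideanreal \<phi>"
    and north: "\<phi> (\<lambda>i. if i = m then 1 else 0) > 0"
    and south: "\<phi> (\<lambda>i. if i = m then -1 else 0) < 0"
  shows "\<not> subtopology (nball m) {x \<in> topspace (nball m). \<phi> x = 0} dim_le int m - 1"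
proof
  let ?D = "nball m"
  define C where "C = {x \<in> topspace ?D. \<phi> x \<in> {0..}}"
  define E where "E = {x \<in> topspace ?D. \<phi> x \<in> {..0}}"
  assume dim: "subtopology ?D {x \<in> topspace ?D. \<phi> x = 0} dim_le int m - 1"
  have C: "closedin ?D C" and E: "closedin ?D E"
    unfolding C_def E_def by (intro closedin_nball_real[OF \<phi>] closed_atLeast closed_atMost)+
  have "C \<inter> E = {x \<in> topspace ?D. \<phi> x = 0}"
    by (auto simp: C_def E_def)
  with dim have CE: "zeros_removable ?D (C \<inter> E) m"
    by (intro dim_le_imp_zeros_removable compact_nball Hausdorff_nball closedin_Int C E) simp
  have normal: "normal_space ?D"
    by (simp add: compact_Hausdorff_or_regular_imp_normal_space compact_nball Hausdorff_nball)
  let ?S = "topspace (nsphere m)"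
  have "closedin ?D {x \<in> topspace ?D. (\<Sum>i\<le>m. (x i)\<^sup>2) \<in> {1}}"
    by (intro closedin_nball_real continuous_map_sum continuous_map_real_pow continuous_map_nball_projection) auto
  also have "{x \<in> topspace ?D. (\<Sum>i\<le>m. (x i)\<^sup>2) \<in> {1}} = ?S"
    by (auto simp: topspace_nball topspace_nsphere)
  finally have S: "closedin ?D ?S" .
  have pole: "x = (\<lambda>i. if i = m then 1 else 0) \<or> x = (\<lambda>i. if i = m then -1 else 0)"
    if x: "x \<in> ?S" "\<And>i. i < m \<Longrightarrow> x i = 0" for x
  proof -
    have "(\<Sum>i\<le>m. (x i)\<^sup>2) = (x m)\<^sup>2"
      using x(2) by (simp flip: lessThan_Suc_atMost)
    with x(1) have "x m = 1 \<or> x m = -1"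
      by (simp add: topspace_nsphere power2_eq_1_iff)
    moreover have "x i = 0" if "i \<noteq> m" for i
      using that x by (cases "i < m") (auto simp: topspace_nsphere)
    ultimately show ?thesis by (auto simp: fun_eq_iff)
  qed
  obtain g where g: "\<And>i. i \<le> m \<Longrightarrow> continuous_map ?D euclideanreal (g i)"
      "\<And>i x. i \<le> m \<Longrightarrow> x \<in> ?S \<Longrightarrow> g i x = x i" "\<And>x. x \<in> C \<union> E \<Longrightarrow> \<exists>i\<le>m. g i x \<noteq> 0"
  proof (rule remove_zeros_across_partition[OF normal C E CE S, of "\<lambda>i x. x i"])
    fix x assume x: "x \<in> ?S" "\<And>i. i < m \<Longrightarrow> x i = 0"
    show "x m > 0" if "x \<in> C"
      using that pole[OF x] south by (auto simp: C_def)
    show "x m < 0" if "x \<in> E"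
      using that pole[OF x] north by (auto simp: E_def)
  qed (auto intro: continuous_map_nball_projection)
  moreover have "C \<union> E = topspace ?D"
    by (auto simp: C_def E_def)
  ultimately show False
    using extension_of_nsphere_identity_has_zero[of m g] by metis
qed

text \<open>
  A continuous injection of the compact ball into a Hausdorff space is an embedding, and the
  dimension passes to subspaces and homeomorphic copies.
\<close>

lemma embedded_separator_not_dim_le:
  assumes "continuous_map (nball m) euclideanreal \<phi>"
    and "\<phi> (\<lambda>i. if i = m then 1 else 0) > 0" and "\<phi> (\<lambda>i. if i = m then -1 else 0) < 0"
    and M: "Hausdorff_space M" and j: "continuous_map (nball m) M j" "inj_on j (topspace (nball m))"
    and N: "\<And>x. x \<in> topspace (nball m) \<Longrightarrow> \<phi> x = 0 \<Longrightarrow> j x \<in> N"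
  shows "\<not> subtopology M N dim_le int m - 1"
proof
  let ?D = "nball m" and ?L = "{x \<in> topspace (nball m). \<phi> x = 0}"
  assume "subtopology M N dim_le int m - 1"
  then have dim: "subtopology M (j ` ?L) dim_le int m - 1"
    by (rule dimension_le_subtopologies) (use N in auto)
  have "embedding_map ?D M j"
    using M j compact_nball by (intro continuous_imp_embedding_map) auto
  then have "homeomorphic_map ?D (subtopology M (j ` topspace ?D)) j"
    by (simp add: embedding_map_def)
  then have "homeomorphic_map (subtopology ?D ?L) (subtopology (subtopology M (j ` topspace ?D)) (j ` ?L)) j"
    using continuous_map_image_subset_topspace[OF j(1)]
    by (intro homeomorphic_map_subtopologies) auto
  moreover have "subtopology (subtopology M (j ` topspace ?D)) (j ` ?L) = subtopology M (j ` ?L)"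
    unfolding subtopology_subtopology by (rule arg_cong[where f = "subtopology M"]) auto
  ultimately have hom: "subtopology ?D ?L homeomorphic_space subtopology M (j ` ?L)"
    by (simp add: homeomorphic_map_imp_homeomorphic_space)
  with dim have "subtopology ?D ?L dim_le int m - 1"
    by (simp only: homeomorphic_space_dimension_le[OF hom])
  with separator_of_poles_not_dim_le[OF assms(1-3)] show False by simp
qed

section \<open>Nodal sets in manifolds\<close>

text \<open>
  Cubes serve as coordinate neighbourhoods because the topology of the Euclidean space is
  the product topology.
\<close>

definition cube :: "nat \<Rightarrow> (nat \<Rightarrow> real) \<Rightarrow> real \<Rightarrow> (nat \<Rightarrow> real) set" where
  "cube n y e = {z \<in> topspace (Euclidean_space n). \<forall>i<n. \<bar>z i - y i\<bar> < e}"

lemma openin_cube: "openin (Euclidean_space n) (cube n y e)"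
proof -
  have "openin (Euclidean_space n) {z \<in> topspace (Euclidean_space n). z i \<in> {y i - e <..< y i + e}}" for i
    unfolding Euclidean_space_def
    by (intro openin_continuous_map_preimage[where Y = euclideanreal] continuous_map_from_subtopology
        continuous_map_product_projection) auto
  then have "openin (Euclidean_space n) (topspace (Euclidean_space n) \<inter>
      (\<Inter>i\<in>{..<n}. {z \<in> topspace (Euclidean_space n). z i \<in> {y i - e <..< y i + e}}))"
    by (cases "n = 0") (auto simp: lessThan_empty_iff intro!: openin_Int openin_INT2)
  also have "topspace (Euclidean_space n) \<inter>
      (\<Inter>i\<in>{..<n}. {z \<in> topspace (Euclidean_space n). z i \<in> {y i - e <..< y i + e}}) = cube n y e"
    by (auto simp: cube_def abs_diff_less_iff algebra_simps)
  finally show ?thesis .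
qed

lemma center_in_cube: "y \<in> topspace (Euclidean_space n) \<Longrightarrow> 0 < e \<Longrightarrow> y \<in> cube n y e"
  by (simp add: cube_def)

lemma cube_mono: "d \<le> e \<Longrightarrow> cube n y d \<subseteq> cube n y e"
  by (force simp: cube_def)

lemma openin_Euclidean_space_contains_cube:
  assumes V: "openin (Euclidean_space n) V" "y \<in> V"
  obtains e where "e > 0" "cube n y e \<subseteq> V"
proof -
  obtain S where S: "openin (powertop_real UNIV) S" "V = S \<inter> {x. \<forall>i\<ge>n. x i = 0}"
    using V(1) by (auto simp: Euclidean_space_def openin_subtopology)
  obtain U where U: "\<And>i. open (U i)" "y \<in> PiE UNIV U" "PiE UNIV U \<subseteq> S"
    using S V(2) unfolding openin_product_topology_alt by fastforce
  have "\<exists>d>0. \<forall>t. \<bar>t - y i\<bar> < d \<longrightarrow> t \<in> U i" for i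
    using U(1)[of i] U(2) by (auto simp: open_dist dist_real_def)
  then obtain d where d: "\<And>i. d i > 0" "\<And>i t. \<bar>t - y i\<bar> < d i \<Longrightarrow> t \<in> U i"
    by metis
  define e where "e = Min (insert 1 (d ` {..<n}))"
  have e: "e > 0" "\<And>i. i < n \<Longrightarrow> e \<le> d i"
    using d(1) by (auto simp: e_def)
  have "z \<in> V" if "z \<in> cube n y e" for z
  proof -
    have "z i \<in> U i" for i
    proof (cases "i < n")
      case True
      then show ?thesis using that e(2)[OF True] by (intro d(2)) (force simp: cube_def)
    next
      case False
      then have "z i = y i"
        using that V S(2) by (auto simp: cube_def topspace_Euclidean_space)
      then show ?thesis using U(2) by auto
    qed
    then show ?thesis
      using U(3) that by (auto simp: S(2) cube_def topspace_Euclidean_space)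
  qed
  with e(1) show thesis using that by blast
qed

lemma manifold_chart:
  assumes M: "topological_manifold n M" and W: "openin M W" "x \<in> W"
  obtains h y e where "e > 0" "y \<in> topspace (Euclidean_space n)" "h y = x"
    "continuous_map (subtopology (Euclidean_space n) (cube n y e)) M h"
    "inj_on h (cube n y e)" "h ` cube n y e \<subseteq> W" "\<And>d. d \<le> e \<Longrightarrow> openin M (h ` cube n y d)"
proof -
  let ?E = "Euclidean_space n"
  have "x \<in> topspace M" using W openin_subset by blast
  then obtain U V where UV: "openin M U" "x \<in> U" "openin ?E V"
      "subtopology M U homeomorphic_space subtopology ?E V"
    using M unfolding topological_manifold_def by blast
  then obtain f g where fg: "homeomorphic_maps (subtopology M U) (subtopology ?E V) f g"
    unfolding homeomorphic_space_def by blast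
  have tU: "topspace (subtopology M U) = U" and tV: "topspace (subtopology ?E V) = V"
    using UV(1,3) openin_subset by force+
  have fx: "f x \<in> V" "g (f x) = x"
    using fg UV(2) tU tV unfolding homeomorphic_maps_def continuous_map_def by auto
  have g: "continuous_map (subtopology ?E V) (subtopology M U) g" "inj_on g V"
    using fg tV unfolding homeomorphic_maps_def inj_on_def by metis+
  have gop: "open_map (subtopology ?E V) (subtopology M U) g"
    using fg homeomorphic_imp_open_map homeomorphic_maps_map by blast
  have gM: "continuous_map (subtopology ?E V) M g"
    using g(1) by (simp add: continuous_map_in_subtopology)
  have "openin (subtopology ?E V) {z \<in> topspace (subtopology ?E V). g z \<in> W}"
    using gM W(1) by (rule openin_continuous_map_preimage)
  then have "openin ?E {z \<in> V. g z \<in> W}"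
    unfolding tV using UV(3) by (rule openin_trans_full)
  then obtain e where e: "e > 0" "cube n (f x) e \<subseteq> {z \<in> V. g z \<in> W}"
    using openin_Euclidean_space_contains_cube[of n _ "f x"] fx W(2) by force
  show thesis
  proof (rule that[of e "f x" g])
    show "f x \<in> topspace ?E" using fx(1) UV(3) openin_subset by blast
    have "subtopology ?E (cube n (f x) e) = subtopology (subtopology ?E V) (cube n (f x) e)"
      using e(2) by (simp add: subtopology_subtopology inf_absorb2 subset_iff)
    then show "continuous_map (subtopology ?E (cube n (f x) e)) M g"
      using gM by (simp add: continuous_map_from_subtopology)
    show "inj_on g (cube n (f x) e)" using g(2) e(2) by (blast intro: inj_on_subset)
    show "openin M (g ` cube n (f x) d)" if "d \<le> e" for d
    proof -
      have "cube n (f x) d \<subseteq> V" using e(2) cube_mono[OF that, of n "f x"] by blast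
      then have "openin (subtopology ?E V) (cube n (f x) d)"
        using UV(3) openin_cube by (simp add: openin_open_subtopology)
      then have "openin (subtopology M U) (g ` cube n (f x) d)"
        using gop by (simp add: open_map_def)
      then show ?thesis using UV(1) openin_trans_full by blast
    qed
  qed (use e fx in auto)
qed

text \<open>
  The ball is mapped affinely, with its axis onto the segment from \<open>a\<close> to \<open>b\<close> and the other
  coordinates scaled by \<open>e/2\<close>. Since \<open>a m \<noteq> b m\<close>, this is injective as a shear, and no rotation has to be
  constructed.
\<close>

lemma nball_into_cube_with_poles:
  assumes a: "a \<in> cube (Suc m) y (e/2)" and b: "b \<in> cube (Suc m) y (e/2)" and ab: "a m \<noteq> b m"
  obtains \<Phi> where "continuous_map (nball m) (subtopology (Euclidean_space (Suc m)) (cube (Suc m) y e)) \<Phi>"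
    "inj_on \<Phi> (topspace (nball m))"
    "\<Phi> (\<lambda>i. if i = m then 1 else 0) = a" "\<Phi> (\<lambda>i. if i = m then -1 else 0) = b"
proof
  have "\<bar>a m - y m\<bar> < e/2" using a by (simp add: cube_def)
  then have e: "e > 0" by linarith
  let ?\<phi> = "\<lambda>z i. (1 + z m) / 2 * a i + (1 - z m) / 2 * b i + (if i < m then e / 2 * z i else 0)"
  define \<Phi> where "\<Phi> = (\<lambda>z i. if i < Suc m then ?\<phi> z i else 0)"
  have "continuous_map (nball m) euclideanreal (\<lambda>z. ?\<phi> z i)" for i
    by (cases "i < m") (auto intro!: continuous_map_add continuous_map_diff continuous_map_real_mult
        continuous_map_real_divide continuous_map_nball_projection)
  then have c: "continuous_map (nball m) (Euclidean_space (Suc m)) \<Phi>"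
    unfolding \<Phi>_def continuous_map_componentwise_Euclidean_space by blast
  have "\<Phi> z \<in> cube (Suc m) y e" if z: "z \<in> topspace (nball m)" for z
  proof -
    have "\<bar>?\<phi> z i - y i\<bar> < e" if i: "i < Suc m" for i
    proof -
      have ai: "\<bar>a i - y i\<bar> < e/2" and bi: "\<bar>b i - y i\<bar> < e/2" and t: "\<bar>z m\<bar> \<le> 1" "\<bar>z i\<bar> \<le> 1"
        using a b i abs_coord_le_1[OF z] by (auto simp: cube_def)
      have "\<bar>(1 + z m) / 2 * (a i - y i) + (1 - z m) / 2 * (b i - y i)\<bar>
          \<le> (1 + z m) / 2 * \<bar>a i - y i\<bar> + (1 - z m) / 2 * \<bar>b i - y i\<bar>"
        using t(1) by (intro order_trans[OF abs_triangle_ineq]) (simp add: abs_mult)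
      also have "\<dots> < e/2"
        by (rule convex_bound_lt[OF ai bi]) (use t(1) in \<open>auto simp: field_simps\<close>)
      finally have "\<bar>(1 + z m) / 2 * (a i - y i) + (1 - z m) / 2 * (b i - y i)\<bar> < e/2" .
      moreover have "\<bar>if i < m then e / 2 * z i else 0\<bar> \<le> e / 2"
        using t(2) e by (simp add: abs_mult mult_left_le)
      moreover have "?\<phi> z i - y i = (1 + z m) / 2 * (a i - y i) + (1 - z m) / 2 * (b i - y i) +
          (if i < m then e / 2 * z i else 0)"
        by (simp add: field_simps)
      ultimately show ?thesis by linarith
    qed
    then show ?thesis
      using c z by (auto simp: cube_def \<Phi>_def topspace_Euclidean_space)
  qed
  with c show "continuous_map (nball m) (subtopology (Euclidean_space (Suc m)) (cube (Suc m) y e)) \<Phi>"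
    by (auto simp: continuous_map_in_subtopology)
  show "inj_on \<Phi> (topspace (nball m))"
  proof (rule inj_onI, rule ext)
    fix z w i assume z: "z \<in> topspace (nball m)" and w: "w \<in> topspace (nball m)" and eq: "\<Phi> z = \<Phi> w"
    have "(z m - w m) * (a m - b m) = 0"
      using fun_cong[OF eq, of m] by (simp add: \<Phi>_def field_simps)
    with ab have m: "z m = w m" by simp
    show "z i = w i"
    proof (cases "i < m")
      case True
      then show ?thesis using fun_cong[OF eq, of i] e m by (simp add: \<Phi>_def)
    next
      case False
      then show ?thesis using z w m by (cases "i = m") (auto simp: topspace_nball)
    qed
  qed
  show "\<Phi> (\<lambda>i. if i = m then 1 else 0) = a" "\<Phi> (\<lambda>i. if i = m then -1 else 0) = b"
    using a b by (auto simp: \<Phi>_def fun_eq_iff cube_def topspace_Euclidean_space)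
qed

text \<open>
  Only the bound needed below, which comes for free: an open set contains an embedded ball together with its
  equatorial disc, and the disc separates the poles of the ball.
\<close>

lemma open_in_manifold_not_dim_le:
  assumes M: "topological_manifold (Suc m) M" and W: "openin M W" "W \<noteq> {}"
  shows "\<not> subtopology M W dim_le int m - 1"
proof -
  obtain x where "x \<in> W" using W(2) by blast
  then obtain h y e where h: "e > 0" "y \<in> topspace (Euclidean_space (Suc m))"
      "continuous_map (subtopology (Euclidean_space (Suc m)) (cube (Suc m) y e)) M h"
      "inj_on h (cube (Suc m) y e)" "h ` cube (Suc m) y e \<subseteq> W"
    using manifold_chart[OF M W(1)] by metis
  have "y(m := y m + e/4) \<in> cube (Suc m) y (e/2)" "y(m := y m - e/4) \<in> cube (Suc m) y (e/2)"
    using h(1,2) by (auto simp: cube_def topspace_Euclidean_space)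
  then obtain \<Phi> where \<Phi>:
      "continuous_map (nball m) (subtopology (Euclidean_space (Suc m)) (cube (Suc m) y e)) \<Phi>"
      "inj_on \<Phi> (topspace (nball m))"
    using h(1) by (rule_tac nball_into_cube_with_poles[of "y(m := y m + e/4)" m y e "y(m := y m - e/4)"]) auto
  have im: "\<Phi> ` topspace (nball m) \<subseteq> cube (Suc m) y e"
    using \<Phi>(1) by (auto simp: continuous_map_in_subtopology)
  show ?thesis
  proof (rule embedded_separator_not_dim_le[where j = "h \<circ> \<Phi>" and \<phi> = "\<lambda>z. z m"])
    show "Hausdorff_space M" using M by (simp add: topological_manifold_def)
    show "continuous_map (nball m) M (h \<circ> \<Phi>)" using \<Phi>(1) h(3) by (rule continuous_map_compose)
    show "inj_on (h \<circ> \<Phi>) (topspace (nball m))"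
      using \<Phi>(2) h(4) im by (blast intro: comp_inj_on inj_on_subset)
    show "(h \<circ> \<Phi>) x \<in> W" if "x \<in> topspace (nball m)" for x
      using that im h(5) by auto
  qed (auto intro: continuous_map_nball_projection)
qed

text \<open>
  A set of codimension at least two does not separate a connected manifold. The nodal set has no
  interior, so the closures of the positive and the negative set cover the manifold and
  meet in some point \<open>x\<close> by connectedness. Near \<open>x\<close> there are points \<open>a\<close> and \<open>b\<close> of either sign, and the
  nodal set separates the poles of a small ball placed along the segment between them.
\<close>

lemma nodal_set_dim_le_imp_constant_sign:
  fixes \<psi> :: "'a \<Rightarrow> real"
  assumes M: "topological_manifold (Suc m) M" "connected_space M"
    and \<psi>: "continuous_map M euclideanreal \<psi>"
    and dim: "subtopology M (nodal_set M \<psi>) dim_le int m - 1"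
  shows "(\<forall>x\<in>topspace M. \<psi> x \<ge> 0) \<or> (\<forall>x\<in>topspace M. \<psi> x \<le> 0)"
proof (rule ccontr)
  let ?E = "Euclidean_space (Suc m)" and ?Q = "cube (Suc m)"
  define P where "P = {x \<in> topspace M. \<psi> x \<in> {0<..}}"
  define N where "N = {x \<in> topspace M. \<psi> x \<in> {..<0}}"
  have op: "openin M P" "openin M N"
    unfolding P_def N_def
    by (rule openin_continuous_map_preimage[OF \<psi>], simp)+
  assume "\<not> ?thesis"
  then have ne: "P \<noteq> {}" "N \<noteq> {}" by (auto simp: P_def N_def not_le)
  have "M closure_of P \<union> M closure_of N = topspace M"
  proof (rule ccontr)
    let ?W = "topspace M - (M closure_of P \<union> M closure_of N)"
    assume "M closure_of P \<union> M closure_of N \<noteq> topspace M"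
    then have "?W \<noteq> {}"
      using closure_of_subset_topspace[of M P] closure_of_subset_topspace[of M N] by blast
    moreover have "openin M ?W"
      by (intro openin_diff closedin_Un closedin_closure_of) auto
    moreover have "P \<subseteq> M closure_of P" "N \<subseteq> M closure_of N"
      using op by (simp_all add: closure_of_subset openin_subset)
    then have "?W \<subseteq> nodal_set M \<psi>"
      by (force simp: nodal_set_def P_def N_def not_less_iff_gr_or_eq)
    ultimately show False
      using dimension_le_subtopologies[OF dim] open_in_manifold_not_dim_le[OF M(1)] by blast
  qed
  then obtain x where x: "x \<in> M closure_of P" "x \<in> M closure_of N"
    using M(2) ne op closure_of_eq_empty[OF openin_subset] unfolding connected_space_closedin_eq
    by (metis closedin_closure_of disjoint_iff)
  then have "x \<in> topspace M" by (simp add: in_closure_of)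
  then obtain h y e where h: "e > 0" "y \<in> topspace ?E" "h y = x"
      "continuous_map (subtopology ?E (?Q y e)) M h" "inj_on h (?Q y e)"
      "\<And>d. d \<le> e \<Longrightarrow> openin M (h ` ?Q y d)"
    using manifold_chart[OF M(1) openin_topspace] by metis
  have "x \<in> h ` ?Q y (e/2)"
    using h(1,2,3) center_in_cube[of y "Suc m" "e/2"] by auto
  moreover have "openin M (h ` ?Q y (e/2))" using h(1) by (intro h(6)) simp
  ultimately have meets: "\<exists>z \<in> ?Q y (e/2). h z \<in> S" if "x \<in> M closure_of S" for S
  proof -
    assume "x \<in> h ` ?Q y (e/2)" "openin M (h ` ?Q y (e/2))"
    then obtain w where "w \<in> S" "w \<in> h ` ?Q y (e/2)"
      using \<open>x \<in> M closure_of S\<close> unfolding in_closure_of by meson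
    then show ?thesis by auto
  qed
  obtain a where a: "a \<in> ?Q y (e/2)" "h a \<in> P"
    using meets[OF x(1)] by auto
  obtain b where b: "b \<in> ?Q y (e/2)" "h b \<in> N"
    using meets[OF x(2)] by auto
  have half: "?Q y (e/2) \<subseteq> ?Q y e" using h(1) by (intro cube_mono) simp
  \<comment> \<open>the positive set is open, so \<open>a\<close> may be moved to differ from \<open>b\<close> in the last coordinate\<close>
  obtain a' where a': "a' \<in> ?Q y (e/2)" "h a' \<in> P" "a' m \<noteq> b m"
  proof (cases "a m = b m")
    case True
    have "openin (subtopology ?E (?Q y e)) {z \<in> topspace (subtopology ?E (?Q y e)). h z \<in> P}"
      using h(4) op(1) by (rule openin_continuous_map_preimage)
    then have "openin ?E {z \<in> topspace (subtopology ?E (?Q y e)). h z \<in> P}"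
      using openin_cube openin_trans_full by blast
    then have "openin ?E ({z \<in> topspace (subtopology ?E (?Q y e)). h z \<in> P} \<inter> ?Q y (e/2))"
      using openin_cube by (rule openin_Int)
    moreover have "a \<in> {z \<in> topspace (subtopology ?E (?Q y e)). h z \<in> P} \<inter> ?Q y (e/2)"
      using a half by (auto simp: cube_def)
    ultimately obtain d where d: "d > 0"
        "?Q a d \<subseteq> {z \<in> topspace (subtopology ?E (?Q y e)). h z \<in> P} \<inter> ?Q y (e/2)"
      using openin_Euclidean_space_contains_cube by metis
    moreover have "a(m := a m + d/2) \<in> ?Q a d"
      using a(1) d(1) by (auto simp: cube_def topspace_Euclidean_space)
    ultimately show ?thesis
      using that[of "a(m := a m + d/2)"] True by auto
  qed (use a that in blast)
  obtain \<Phi> where \<Phi>: "continuous_map (nball m) (subtopology ?E (?Q y e)) \<Phi>"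
      "inj_on \<Phi> (topspace (nball m))"
      "\<Phi> (\<lambda>i. if i = m then 1 else 0) = a'" "\<Phi> (\<lambda>i. if i = m then -1 else 0) = b"
    by (rule nball_into_cube_with_poles[OF a'(1) b(1) a'(3)])
  have im: "\<Phi> ` topspace (nball m) \<subseteq> ?Q y e"
    using \<Phi>(1) by (auto simp: continuous_map_in_subtopology)
  have c: "continuous_map (nball m) M (h \<circ> \<Phi>)"
    using \<Phi>(1) h(4) by (rule continuous_map_compose)
  have "\<not> subtopology M (nodal_set M \<psi>) dim_le int m - 1"
  proof (rule embedded_separator_not_dim_le[where j = "h \<circ> \<Phi>" and \<phi> = "\<psi> \<circ> (h \<circ> \<Phi>)"])
    show "Hausdorff_space M" using M by (simp add: topological_manifold_def)
    show "continuous_map (nball m) euclideanreal (\<psi> \<circ> (h \<circ> \<Phi>))"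
      using c \<psi> by (rule continuous_map_compose)
    show "inj_on (h \<circ> \<Phi>) (topspace (nball m))"
      using \<Phi>(2) h(5) im by (blast intro: comp_inj_on inj_on_subset)
    show "(h \<circ> \<Phi>) z \<in> nodal_set M \<psi>"
      if "z \<in> topspace (nball m)" "(\<psi> \<circ> (h \<circ> \<Phi>)) z = 0" for z
      using that continuous_map_image_subset_topspace[OF c] by (auto simp: nodal_set_def)
  qed (use \<Phi> a' b c in \<open>auto simp: P_def N_def\<close>)
  with dim show False by blast
qed

section \<open>Eigenfunctions of symmetric operators\<close>

lemma scalar_cnj_of_real: "scalar_cnj (of_real r :: 'k::l2_scalar) = of_real r"
proof (cases "r = 0")
  case True
  then show ?thesis
    using linear_0[OF bounded_linear.linear[OF bounded_linear_scalar_cnj]] by simp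
next
  case False
  have "of_real r * scalar_cnj (of_real r :: 'k) = of_real r * of_real r"
    by (simp add: mult_scalar_cnj scaleR_conv_of_real power2_eq_square)
  with False show ?thesis by simp
qed

lemma L2_fun_of_real_mult_integrable:
  assumes "(\<lambda>x. of_real (f x) :: 'k::l2_scalar) \<in> L2_fun \<mu>" "(\<lambda>x. of_real (g x) :: 'k) \<in> L2_fun \<mu>"
    and [measurable]: "f \<in> borel_measurable \<mu>" "g \<in> borel_measurable \<mu>"
  shows "integrable \<mu> (\<lambda>x. f x * g x :: real)"
proof (rule Bochner_Integration.integrable_bound)
  show "integrable \<mu> (\<lambda>x. (f x)\<^sup>2 + (g x)\<^sup>2)"
    using assms(1,2) by (auto simp: L2_fun_def)
  show "AE x in \<mu>. norm (f x * g x) \<le> norm ((f x)\<^sup>2 + (g x)\<^sup>2)"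
  proof (rule AE_I2)
    fix x
    have "2 * \<bar>f x\<bar> * \<bar>g x\<bar> \<le> (f x)\<^sup>2 + (g x)\<^sup>2"
      using sum_squares_bound[of "\<bar>f x\<bar>" "\<bar>g x\<bar>"] by simp
    moreover have "0 \<le> \<bar>f x\<bar> * \<bar>g x\<bar>" by simp
    ultimately have "\<bar>f x\<bar> * \<bar>g x\<bar> \<le> (f x)\<^sup>2 + (g x)\<^sup>2" by linarith
    then show "norm (f x * g x) \<le> norm ((f x)\<^sup>2 + (g x)\<^sup>2)"
      by (simp add: abs_mult)
  qed
qed simp

lemma inner_of_real_class:
  fixes f g :: "'a \<Rightarrow> real"
  assumes "(\<lambda>x. of_real (f x) :: 'k::l2_scalar) \<in> L2_fun \<mu>" "(\<lambda>x. of_real (g x) :: 'k) \<in> L2_fun \<mu>"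
    and "integrable \<mu> (\<lambda>x. f x * g x)"
  shows "L2_inner \<mu> (L2_scale \<mu> c (L2_class \<mu> (\<lambda>x. of_real (f x) :: 'k))) (L2_class \<mu> (\<lambda>x. of_real (g x)))
           = c * of_real (\<integral>x. f x * g x \<partial>\<mu>)"
    and "L2_inner \<mu> (L2_class \<mu> (\<lambda>x. of_real (f x) :: 'k)) (L2_scale \<mu> c (L2_class \<mu> (\<lambda>x. of_real (g x))))
           = scalar_cnj c * of_real (\<integral>x. f x * g x \<partial>\<mu>)"
proof -
  have "(\<integral>x. of_real (f x * g x) \<partial>\<mu>) = (of_real (\<integral>x. f x * g x \<partial>\<mu>) :: 'k)"
    using assms(3) by (rule integral_of_real)
  then have *: "(\<integral>x. d * of_real (f x * g x) \<partial>\<mu>) = d * (of_real (\<integral>x. f x * g x \<partial>\<mu>) :: 'k)" for d :: 'k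
    by (simp only: integral_mult_right_zero)
  show "L2_inner \<mu> (L2_scale \<mu> c (L2_class \<mu> (\<lambda>x. of_real (f x) :: 'k))) (L2_class \<mu> (\<lambda>x. of_real (g x)))
           = c * of_real (\<integral>x. f x * g x \<partial>\<mu>)"
    using assms *[of c]
    by (simp add: L2_scale_class L2_inner_class L2_fun_scale scalar_cnj_of_real mult.assoc)
  show "L2_inner \<mu> (L2_class \<mu> (\<lambda>x. of_real (f x) :: 'k)) (L2_scale \<mu> c (L2_class \<mu> (\<lambda>x. of_real (g x))))
           = scalar_cnj c * of_real (\<integral>x. f x * g x \<partial>\<mu>)"
    using assms *[of "scalar_cnj c"]
    by (simp add: L2_scale_class L2_inner_class L2_fun_scale scalar_cnj_of_real scalar_cnj_mult ac_simps)
qed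

lemma eigenspace_imp_L2_fun:
  assumes "symmetric_operator \<mu> D T" "L2_class \<mu> f \<in> eigenspace \<mu> D T \<kappa>"
  shows "f \<in> L2_fun \<mu>"
proof -
  have "L2_class \<mu> f \<in> L2_fun \<mu> // L2_rel \<mu>"
    using assms by (auto simp: eigenspace_def symmetric_operator_def L2_subspace_def L2_def)
  then have "L2_class \<mu> f \<noteq> {}"
    using in_quotient_imp_non_empty[OF equiv_L2_rel] by blast
  then show ?thesis using mem_L2_class_iff by blast
qed

text \<open>
  Eigenfunctions with non-conjugate eigenvalues are orthogonal. The conjugation is kept because
  the scalars may be complex; taking \<open>f = g\<close> shows that the eigenvalue is self-conjugate.
\<close>

lemma symmetric_operator_eigenvalue_eq:
  fixes f g :: "'a \<Rightarrow> real" and \<kappa> \<kappa>' :: "'k::l2_scalar"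
  assumes T: "symmetric_operator \<mu> D T"
    and f: "L2_class \<mu> (\<lambda>x. of_real (f x)) \<in> eigenspace \<mu> D T \<kappa>" "f \<in> borel_measurable \<mu>"
    and g: "L2_class \<mu> (\<lambda>x. of_real (g x)) \<in> eigenspace \<mu> D T \<kappa>'" "g \<in> borel_measurable \<mu>"
    and "(\<integral>x. f x * g x \<partial>\<mu>) \<noteq> 0"
  shows "\<kappa> = scalar_cnj \<kappa>'"
proof -
  note L2 = eigenspace_imp_L2_fun[OF T]
  let ?F = "L2_class \<mu> (\<lambda>x. of_real (f x) :: 'k)" and ?G = "L2_class \<mu> (\<lambda>x. of_real (g x) :: 'k)"
  have "L2_inner \<mu> (T ?F) ?G = L2_inner \<mu> ?F (T ?G)"
    using T f(1) g(1) unfolding symmetric_operator_def eigenspace_def by blast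
  moreover have "T ?F = L2_scale \<mu> \<kappa> ?F" "T ?G = L2_scale \<mu> \<kappa>' ?G"
    using f(1) g(1) by (simp_all add: eigenspace_def)
  moreover have "integrable \<mu> (\<lambda>x. f x * g x)"
    using L2_fun_of_real_mult_integrable[OF L2[OF f(1)] L2[OF g(1)] f(2) g(2)] .
  ultimately have "\<kappa> * of_real (\<integral>x. f x * g x \<partial>\<mu>) = scalar_cnj \<kappa>' * of_real (\<integral>x. f x * g x \<partial>\<mu>)"
    using inner_of_real_class[OF L2[OF f(1)] L2[OF g(1)]] by metis
  with assms(6) show ?thesis by simp
qed

lemma continuous_map_borel_measurable:
  assumes "borel_measure_on X \<mu>" "continuous_map X euclideanreal f"
  shows "f \<in> borel_measurable \<mu>"
proof (rule borel_measurableI)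
  fix S :: "real set" assume "open S"
  then have "openin X {x \<in> topspace X. f x \<in> S}"
    using assms(2) by (intro openin_continuous_map_preimage[where Y = euclideanreal]) auto
  then show "f -` S \<inter> space \<mu> \<in> sets \<mu>"
    using assms(1) by (auto simp: borel_measure_on_def vimage_def Int_def conj_commute intro: sigma_sets.Basic)
qed

text \<open>
  A continuous function that vanishes almost everywhere vanishes everywhere when no nonempty
  open set is null.
\<close>

lemma integral_eq_0_imp_zero:
  fixes f :: "'a \<Rightarrow> real"
  assumes \<mu>: "borel_measure_on X \<mu>"
    and pos: "\<And>U. openin X U \<Longrightarrow> U \<noteq> {} \<Longrightarrow> emeasure \<mu> U > 0"
    and f: "continuous_map X euclideanreal f" "integrable \<mu> f"
    and sgn: "(\<forall>x\<in>topspace X. f x \<ge> 0) \<or> (\<forall>x\<in>topspace X. f x \<le> 0)"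
    and 0: "(\<integral>x. f x \<partial>\<mu>) = 0" and x: "x \<in> topspace X"
  shows "f x = 0"
proof -
  have sp: "space \<mu> = topspace X" using \<mu> by (simp add: borel_measure_on_def)
  have "AE x in \<mu>. f x = 0"
    using sgn
  proof
    assume "\<forall>x\<in>topspace X. f x \<ge> 0"
    then have "AE x in \<mu>. 0 \<le> f x" by (intro AE_I2) (simp add: sp)
    then show ?thesis
      using integral_nonneg_eq_0_iff_AE[OF f(2)] 0 by simp
  next
    assume "\<forall>x\<in>topspace X. f x \<le> 0"
    then have "AE x in \<mu>. 0 \<le> - f x" by (intro AE_I2) (simp add: sp)
    then show ?thesis
      using integral_nonneg_eq_0_iff_AE[of \<mu> "\<lambda>x. - f x"] f(2) 0 by simp
  qed
  moreover have op: "openin X {x \<in> topspace X. f x \<in> - {0}}"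
    by (rule openin_continuous_map_preimage[OF f(1)]) (simp add: open_Compl)
  moreover have "{x \<in> topspace X. f x \<in> - {0}} \<in> sets \<mu>"
    using op \<mu> by (auto simp: borel_measure_on_def intro: sigma_sets.Basic)
  ultimately have "emeasure \<mu> {x \<in> topspace X. f x \<in> - {0}} = 0"
    by (subst (asm) AE_iff_measurable[of "{x \<in> topspace X. f x \<in> - {0}}"]) (auto simp: sp)
  with pos[OF op] x show ?thesis by force
qed

theorem mainTheorem1:
  fixes n :: nat and M :: "'a topology" and \<mu> :: "'a measure"
    and D :: "('a \<Rightarrow> 'k::l2_scalar) set set"
    and T :: "('a \<Rightarrow> 'k) set \<Rightarrow> ('a \<Rightarrow> 'k) set"
    and \<psi>1 \<psi>2 :: "'a \<Rightarrow> real" and \<kappa>1 \<kappa>2 :: 'k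
  assumes "topological_manifold n M" and "metrizable_space M" and "connected_space M"
    and "borel_measure_on M \<mu>"
    and "\<And>U. openin M U \<Longrightarrow> U \<noteq> {} \<Longrightarrow> emeasure \<mu> U > 0"
    and "symmetric_operator \<mu> D T"
    and "is_eigenvalue \<mu> D T \<kappa>1" and "is_eigenvalue \<mu> D T \<kappa>2"
    and "continuous_map M euclideanreal \<psi>1" and "continuous_map M euclideanreal \<psi>2"
    and "L2_class \<mu> (\<lambda>x. of_real (\<psi>1 x)) \<in> eigenspace \<mu> D T \<kappa>1"
    and "L2_class \<mu> (\<lambda>x. of_real (\<psi>2 x)) \<in> eigenspace \<mu> D T \<kappa>2"
    and "dim_less (subtopology M (nodal_set M \<psi>1)) (int n - 1)"
    and "dim_less (subtopology M (nodal_set M \<psi>2)) (int n - 1)"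
  shows "\<kappa>1 = \<kappa>2"
proof -
  have nz: "topspace M \<noteq> {}"
  proof
    assume "topspace M = {}"
    then have sp: "space \<mu> = {}" using assms(4) by (simp add: borel_measure_on_def)
    obtain F where "F \<in> eigenspace \<mu> D T \<kappa>1" and F0: "F \<noteq> L2_zero \<mu>"
      using assms(7) unfolding is_eigenvalue_def by blast
    then have "F \<in> L2 \<mu>"
      using assms(6) by (auto simp: eigenspace_def symmetric_operator_def L2_subspace_def)
    then obtain f where f: "f \<in> L2_fun \<mu>" "F = L2_class \<mu> f"
      by (auto simp: L2_def L2_class_def quotient_def)
    have "(\<lambda>x. 0 :: 'k) \<in> L2_fun \<mu>" by (simp add: L2_fun_def)
    moreover have "AE x in \<mu>. f x = 0" by (rule AE_I2) (simp add: sp)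
    ultimately have "F = L2_zero \<mu>"
      using f by (simp add: L2_zero_def L2_class_eq_iff)
    with F0 show False by simp
  qed
  have "n \<noteq> 0"
    using assms(13) dimension_le_bound by (fastforce simp: dim_less_def)
  then obtain m where n: "n = Suc m" using not0_implies_Suc by blast
  have M: "topological_manifold (Suc m) M" using assms(1) n by simp
  have dim: "subtopology M (nodal_set M \<psi>1) dim_le int m - 1"
      "subtopology M (nodal_set M \<psi>2) dim_le int m - 1"
    using assms(13,14) n by (auto simp: dim_less_def elim: dimension_le_mono)
  have sgn: "(\<forall>x\<in>topspace M. \<psi>1 x \<ge> 0) \<or> (\<forall>x\<in>topspace M. \<psi>1 x \<le> 0)"
      "(\<forall>x\<in>topspace M. \<psi>2 x \<ge> 0) \<or> (\<forall>x\<in>topspace M. \<psi>2 x \<le> 0)"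
    using nodal_set_dim_le_imp_constant_sign[OF M assms(3)] assms(9,10) dim by blast+
  have nonzero_somewhere: "\<exists>x\<in>U. \<psi> x \<noteq> 0"
    if "openin M U" "U \<noteq> {}" "subtopology M (nodal_set M \<psi>) dim_le int m - 1" for U \<psi>
  proof (rule ccontr)
    assume "\<not> ?thesis"
    then have "U \<subseteq> nodal_set M \<psi>"
      using openin_subset[OF that(1)] by (auto simp: nodal_set_def)
    then show False
      using open_in_manifold_not_dim_le[OF M that(1,2)] dimension_le_subtopologies[OF that(3)] by blast
  qed
  have "openin M {x \<in> topspace M. \<psi>1 x \<in> - {0}}"
    by (rule openin_continuous_map_preimage[OF assms(9)]) (simp add: open_Compl)
  moreover have "{x \<in> topspace M. \<psi>1 x \<in> - {0}} \<noteq> {}"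
    using nonzero_somewhere[OF openin_topspace nz dim(1)] by auto
  ultimately obtain x where x: "x \<in> topspace M" "\<psi>1 x \<noteq> 0" "\<psi>2 x \<noteq> 0"
    using nonzero_somewhere[OF _ _ dim(2)] by force
  have meas: "\<psi>1 \<in> borel_measurable \<mu>" "\<psi>2 \<in> borel_measurable \<mu>"
    using continuous_map_borel_measurable[OF assms(4)] assms(9,10) by auto
  have nz_int: "(\<integral>x. \<phi> x * \<psi> x \<partial>\<mu>) \<noteq> 0" if mem: "\<phi> \<in> {\<psi>1, \<psi>2}" "\<psi> \<in> {\<psi>1, \<psi>2}" for \<phi> \<psi>
  proof
    assume 0: "(\<integral>x. \<phi> x * \<psi> x \<partial>\<mu>) = 0"
    have L2: "(\<lambda>x. of_real (\<rho> x) :: 'k) \<in> L2_fun \<mu>" if "\<rho> \<in> {\<psi>1, \<psi>2}" for \<rho>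
      using that eigenspace_imp_L2_fun[OF assms(6)] assms(11,12) by blast
    have "integrable \<mu> (\<lambda>x. \<phi> x * \<psi> x)"
      using L2_fun_of_real_mult_integrable[OF L2 L2] mem meas by blast
    moreover have "continuous_map M euclideanreal (\<lambda>x. \<phi> x * \<psi> x)"
      using mem assms(9,10) by (intro continuous_map_real_mult) auto
    moreover have "(\<forall>x\<in>topspace M. \<phi> x * \<psi> x \<ge> 0) \<or> (\<forall>x\<in>topspace M. \<phi> x * \<psi> x \<le> 0)"
    proof -
      have "(\<forall>x\<in>topspace M. \<rho> x \<ge> 0) \<or> (\<forall>x\<in>topspace M. \<rho> x \<le> 0)" if "\<rho> \<in> {\<psi>1, \<psi>2}" for \<rho>
        using that sgn by blast
      from this[OF mem(1)] this[OF mem(2)] show ?thesis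
        by (auto simp: zero_le_mult_iff mult_le_0_iff)
    qed
    ultimately have "\<phi> x * \<psi> x = 0"
      using integral_eq_0_imp_zero[OF assms(4,5)] 0 x(1) by blast
    with x mem show False by auto
  qed
  have "\<kappa>1 = scalar_cnj \<kappa>2"
    by (rule symmetric_operator_eigenvalue_eq[OF assms(6,11) meas(1) assms(12) meas(2) nz_int]) auto
  moreover have "\<kappa>2 = scalar_cnj \<kappa>2"
    by (rule symmetric_operator_eigenvalue_eq[OF assms(6,12) meas(2) assms(12) meas(2) nz_int]) auto
  ultimately show ?thesis by simp
qed

end
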